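(* For all positive integers $n,d,k$, the set $\Sigma_{n,2d}^{k}$ is a closed convex cone in $F_{n,2d}$.
   Context: For positive integers $n,d$, $F_{n,d}$ denotes the real vector space of forms (homogeneous polynomials, including $0$) of degree $d$ in $n$ variables $x_1,\dots,x_n$ with real coefficients. $F_{n,d}^k\subset F_{n,d}$ denotes the subset of forms with at most $k$ terms, i.e. with at most $k$ monomials having nonzero coefficient. Define $\Sigma_{n,2d}^k=\left\{\sum_{j=1}^m h_j^2 \ \big|\ m\in\mathbb N,\ h_j\in F_{n,d}^k\right\}\subset F_{n,2d}$. The topology on $F_{n,2d}$ is the usual one of a finite-dimensional real vector space (coefficientwise convergence). *)

theory Defs
  imports
    "HOL-Analysis.Analysis"
    "HOL-Analysis.Finite_Function_Topology"
begin

text \<open>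
  Real polynomials in the variables \<open>x\<^sub>1, x\<^sub>2, \<dots>\<close>: finitely supported families of
  coefficients indexed by monomials, a monomial being its finitely supported family of exponents.
\<close>

type_synonym rpoly = "(nat \<Rightarrow>\<^sub>0 nat) \<Rightarrow>\<^sub>0 real"

definition monomials :: "nat \<Rightarrow> nat \<Rightarrow> (nat \<Rightarrow>\<^sub>0 nat) set" where
  "monomials n d =
     {t. Poly_Mapping.keys t \<subseteq> {1..n} \<and> (\<Sum>i=1..n. Poly_Mapping.lookup t i) = d}"

definition forms :: "nat \<Rightarrow> nat \<Rightarrow> rpoly set" where
  "forms n d = {p. Poly_Mapping.keys p \<subseteq> monomials n d}"

definition sparse_forms :: "nat \<Rightarrow> nat \<Rightarrow> nat \<Rightarrow> rpoly set" where
  "sparse_forms n d k = {p \<in> forms n d. card (Poly_Mapping.keys p) \<le> k}"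

text \<open>\<open>sparse_sos n d k\<close> is \<open>\<Sigma>\<^bsub>n,2d\<^esub>\<^bsup>k\<^esup>\<close>: \<open>d\<close> is the degree of the summands \<open>h j\<close>, not of
  their squares.\<close>

definition sparse_sos :: "nat \<Rightarrow> nat \<Rightarrow> nat \<Rightarrow> rpoly set" where
  "sparse_sos n d k =
     {(\<Sum>j=1..m. (h j)\<^sup>2) | (m::nat) (h :: nat \<Rightarrow> rpoly). \<forall>j\<in>{1..m}. h j \<in> sparse_forms n d k}"

text \<open>
  The topology on \<^typ>\<open>rpoly\<close> is that of the library's norm, the sum of the absolute values
  of the coefficients. On the finite-dimensional subspace \<^term>\<open>forms n d\<close> it is the usual
  topology; the last lemma below confirms that convergence is coefficientwise there.
\<close>

lemma finite_monomials: "finite (monomials n d)"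
proof -
  have "Poly_Mapping.lookup ` monomials n d \<subseteq> {f. \<forall>i. (i \<in> {1..n} \<longrightarrow> f i \<in> {..d}) \<and> (i \<notin> {1..n} \<longrightarrow> f i = 0)}"
  proof (clarsimp simp: monomials_def, intro conjI impI)
    fix t :: "nat \<Rightarrow>\<^sub>0 nat" and i
    assume t: "Poly_Mapping.keys t \<subseteq> {Suc 0..n}"
    show "Poly_Mapping.lookup t i \<le> (\<Sum>i = Suc 0..n. Poly_Mapping.lookup t i)"
      if "Suc 0 \<le> i \<and> i \<le> n"
      using that by (intro member_le_sum) auto
    show "Poly_Mapping.lookup t i = 0" if "Suc 0 \<le> i \<longrightarrow> \<not> i \<le> n"
      using that t by (auto simp: in_keys_iff subset_iff)
  qed
  moreover have "finite {f. \<forall>i. (i \<in> {1..n} \<longrightarrow> f i \<in> {..d}) \<and> (i \<notin> {1..n} \<longrightarrow> f i = (0::nat))}"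
    by (rule finite_set_of_finite_funs) auto
  ultimately have "finite (Poly_Mapping.lookup ` monomials n d)"
    by (rule finite_subset)
  then show ?thesis
    by (rule finite_imageD) (simp add: inj_on_def)
qed

lemma dist_forms:
  assumes "p \<in> forms n d" "q \<in> forms n d"
  shows "dist p q = (\<Sum>t\<in>monomials n d. \<bar>Poly_Mapping.lookup p t - Poly_Mapping.lookup q t\<bar>)"
  unfolding dist_poly_mapping_def dist_real_def
  using assms finite_monomials
  by (intro sum.mono_neutral_left) (auto simp: forms_def in_keys_iff)

lemma tendsto_forms_iff:
  assumes f: "\<And>j. f j \<in> forms n d" and p: "p \<in> forms n d"
  shows "f \<longlonglongrightarrow> p \<longleftrightarrow> (\<forall>t. (\<lambda>j. Poly_Mapping.lookup (f j) t) \<longlonglongrightarrow> Poly_Mapping.lookup p t)"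
proof
  assume lim: "f \<longlonglongrightarrow> p"
  show "\<forall>t. (\<lambda>j. Poly_Mapping.lookup (f j) t) \<longlonglongrightarrow> Poly_Mapping.lookup p t"
  proof
    fix t
    have "dist (Poly_Mapping.lookup (f j) t) (Poly_Mapping.lookup p t) \<le> dist (f j) p" for j
    proof (cases "t \<in> monomials n d")
      case True
      then show ?thesis
        unfolding dist_forms[OF f p] dist_real_def
        using finite_monomials by (intro member_le_sum) auto
    next
      case False
      then have "Poly_Mapping.lookup (f j) t = 0" "Poly_Mapping.lookup p t = 0"
        using f[of j] p by (auto simp: forms_def in_keys_iff)
      then show ?thesis by simp
    qed
    then show "(\<lambda>j. Poly_Mapping.lookup (f j) t) \<longlonglongrightarrow> Poly_Mapping.lookup p t"
      using lim unfolding tendsto_dist_iff[where l = p]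
        tendsto_dist_iff[where l = "Poly_Mapping.lookup p t"]
      by (rule_tac tendsto_sandwich[where f = "\<lambda>_. 0"]) auto
  qed
next
  assume "\<forall>t. (\<lambda>j. Poly_Mapping.lookup (f j) t) \<longlonglongrightarrow> Poly_Mapping.lookup p t"
  then have "(\<lambda>j. \<Sum>t\<in>monomials n d. \<bar>Poly_Mapping.lookup (f j) t - Poly_Mapping.lookup p t\<bar>) \<longlonglongrightarrow> 0"
    by (intro tendsto_null_sum tendsto_rabs_zero) (simp add: LIM_zero)
  then show "f \<longlonglongrightarrow> p"
    by (simp add: tendsto_dist_iff[where l = p] dist_forms[OF f p])
qed

end

(*
  Every nonzero square is positive for the lexicographic order on polynomials, because its lowest
  coefficient is a square. So 0 is not in the convex hull K of the squares of k-sparse forms of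
  norm 1. Those squares form a compact subset of a finite-dimensional space, hence K is compact by
  Caratheodory's theorem, and the cone generated by a compact convex set avoiding 0 is closed.
*)
theory Submission
  imports Defs
begin

section \<open>Convex hulls in finite-dimensional subspaces\<close>

text \<open>Moving one point of \<open>A\<close> to the origin turns the remaining points into a
  linearly independent subset of \<open>span B\<close>, so there are at most \<open>card B\<close>
  of them. The \<open>Suc\<close> counts the point that was moved.\<close>

lemma card_affine_independent_le:
  fixes A :: "'a::real_vector set"
  assumes B: "finite B" "A \<subseteq> span B" and A: "\<not> affine_dependent A"
  shows "finite A" "card A \<le> Suc (card B)"
proof -
  have "finite A \<and> card A \<le> Suc (card B)"
  proof (cases "A = {}")
    case False
    then obtain a where a: "a \<in> A" by blast
    let ?D = "(\<lambda>x. - a + x) ` (A - {a})"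
    have "independent ?D"
      using A a affine_dependent_iff_dependent2 by blast
    moreover have "?D \<subseteq> span B"
      using B(2) a by (auto intro!: span_diff)
    ultimately have D: "finite ?D" "card ?D \<le> card B"
      using independent_span_bound[OF B(1)] by blast+
    have inj: "inj_on (\<lambda>x. - a + x) (A - {a})"
      by (simp add: inj_on_def)
    have "finite (A - {a})" "card (A - {a}) \<le> card B"
      using D finite_imageD[OF _ inj] card_image[OF inj] by auto
    then show ?thesis
      using a by (simp add: card_Diff_singleton)
  qed simp
  then show "finite A" "card A \<le> Suc (card B)" by auto
qed

text \<open>Subtracting a multiple of an affine dependence changes neither the represented point nor
  the sum of the coefficients. A suitable multiple makes one coefficient vanish while the others
  stay nonnegative.\<close>

lemma convex_hull_remove_affine_dependent:
  fixes A :: "'a::real_vector set"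
  assumes "finite A" "affine_dependent A" "x \<in> convex hull A"
  shows "\<exists>a\<in>A. x \<in> convex hull (A - {a})"
proof -
  obtain c where c: "\<And>v. v \<in> A \<Longrightarrow> 0 \<le> c v" "sum c A = 1" "(\<Sum>v\<in>A. c v *\<^sub>R v) = x"
    using assms(3) unfolding convex_hull_finite[OF assms(1)] by auto
  obtain w v0 where w: "sum w A = 0" "(\<Sum>v\<in>A. w v *\<^sub>R v) = 0" "v0 \<in> A" "w v0 \<noteq> 0"
    using assms(2) unfolding affine_dependent_explicit_finite[OF assms(1)] by blast
  let ?P = "{v \<in> A. w v \<noteq> 0}"
  have P: "finite ?P" "?P \<noteq> {}"
    using assms(1) w by auto
  \<comment> \<open>The minimal ratio is taken with \<open>\<bar>w v\<bar>\<close>, so the sign of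
    \<open>w a\<close> is irrelevant: it gives \<open>\<bar>t * w v\<bar> \<le> c v\<close> for all
    \<open>v\<close>, hence \<open>c' v\<close> is nonnegative whichever sign \<open>t * w v\<close>
    has.\<close>
  obtain a where a: "a \<in> ?P" "\<And>v. v \<in> ?P \<Longrightarrow> c a / \<bar>w a\<bar> \<le> c v / \<bar>w v\<bar>"
    using arg_min_if_finite(1)[OF P, of "\<lambda>v. c v / \<bar>w v\<bar>"]
      arg_min_least[OF P, of _ "\<lambda>v. c v / \<bar>w v\<bar>"] by blast
  define t where "t = c a / w a"
  define c' where "c' v = c v - t * w v" for v
  have "0 \<le> c' v" if "v \<in> A" for v
  proof (cases "w v = 0")
    case False
    have "\<bar>t\<bar> \<le> c v / \<bar>w v\<bar>"
      using a c(1)[of a] False that by (simp add: t_def abs_divide)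
    then have "\<bar>t * w v\<bar> \<le> c v"
      using False by (simp add: abs_mult field_simps)
    then show ?thesis by (simp add: c'_def)
  qed (use c that in \<open>simp add: c'_def\<close>)
  moreover have "c' a = 0"
    using a by (simp add: c'_def t_def)
  moreover have "sum c' A = 1"
    using c w by (simp add: c'_def sum_subtractf flip: sum_distrib_left)
  moreover have "(\<Sum>v\<in>A. c' v *\<^sub>R v) = x"
    using c w by (simp add: c'_def scaleR_diff_left sum_subtractf flip: scaleR_scaleR scaleR_sum_right)
  ultimately have "x \<in> convex hull (A - {a})"
    using a assms(1) by (subst convex_hull_finite) (auto simp: sum_diff1 intro!: exI[of _ c'])
  then show ?thesis using a by blast
qed

text \<open>Caratheodory's theorem relative to a finite spanning set: a subset of least cardinality
  whose hull contains \<open>x\<close> is affinely independent, since otherwise one of its points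
  could be dropped.\<close>

lemma caratheodory_finite_span:
  fixes S :: "'a::real_vector set"
  assumes "finite B" "S \<subseteq> span B" "x \<in> convex hull S"
  obtains A where "finite A" "A \<subseteq> S" "card A \<le> Suc (card B)" "x \<in> convex hull A"
proof -
  let ?P = "\<lambda>A. finite A \<and> A \<subseteq> S \<and> x \<in> convex hull A"
  obtain A0 u where A0: "finite A0" "A0 \<subseteq> S"
    and "\<forall>v\<in>A0. 0 \<le> u v" "sum u A0 = 1" "(\<Sum>v\<in>A0. u v *\<^sub>R v) = x"
    using assms(3) unfolding convex_hull_explicit by blast
  then have "?P A0"
    unfolding convex_hull_finite[OF A0(1)] by blast
  then obtain A where A: "?P A" and min: "\<And>A'. ?P A' \<Longrightarrow> card A \<le> card A'"
    using ex_has_least_nat[of ?P A0 card] by auto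
  have "\<not> affine_dependent A"
  proof
    assume "affine_dependent A"
    then obtain a where a: "a \<in> A" "x \<in> convex hull (A - {a})"
      using convex_hull_remove_affine_dependent[of A x] A by auto
    then have "card A \<le> card (A - {a})"
      using A by (intro min) auto
    then show False
      using A a by (metis card_Diff1_less not_le)
  qed
  moreover have "A \<subseteq> span B"
    using A assms(2) by auto
  ultimately have "card A \<le> Suc (card B)"
    using card_affine_independent_le(2) assms(1) by metis
  then show thesis
    using A that[of A] by simp
qed

text \<open>The hull is built in stages, each joining the points of \<open>S\<close> to the previous
  stage. Every stage is compact, and Caratheodory's theorem shows that stage \<open>card B\<close>
  is already the whole hull.\<close>

lemma compact_convex_hull_finite_span:
  fixes S :: "'a::real_normed_vector set"
  assumes "compact S" "finite B" "S \<subseteq> span B"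
  shows "compact (convex hull S)"
proof -
  let ?step = "\<lambda>T. {(1 - u) *\<^sub>R x + u *\<^sub>R y |x y u. 0 \<le> u \<and> u \<le> 1 \<and> x \<in> S \<and> y \<in> T}"
  define T where "T = rec_nat S (\<lambda>_. ?step)"
  have T_0: "T 0 = S" and T_Suc: "T (Suc m) = ?step (T m)" for m
    by (simp_all add: T_def)
  have compact: "compact (T m)" for m
    by (induction m) (simp_all add: T_0 T_Suc assms(1) compact_convex_combinations)
  have subset: "T m \<subseteq> convex hull S" for m
  proof (induction m)
    case (Suc m)
    then show ?case
      using hull_subset[of S convex] by (auto simp: T_Suc intro!: convexD_alt[OF convex_convex_hull])
  qed (simp add: T_0 hull_subset)
  \<comment> \<open>Stage 0 is \<open>S\<close> itself and handles single points, so stage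
    \<open>m\<close> handles \<open>Suc m\<close> points. This matches the bound
    \<open>Suc (card B)\<close>.\<close>
  have hull: "convex hull A \<subseteq> T m"
    if "finite A" "A \<subseteq> S" "card A \<le> Suc m" for A m
    using that
  proof (induction m arbitrary: A)
    case 0
    then have "A = {} \<or> (\<exists>a. A = {a})"
      by (metis One_nat_def card_0_eq card_1_singletonE le_Suc_eq le_zero_eq)
    then show ?case using 0 by (auto simp: T_0)
  next
    case (Suc m)
    consider "A = {}" | a where "A = {a}" | a A' where "A = insert a A'" "a \<notin> A'" "A' \<noteq> {}"
      by (metis Set.set_insert ex_in_conv)
    then show ?case
    proof cases
      case (2 a)
      \<comment> \<open>A single point is the trivial combination of itself with itself, so it must
        already lie in the previous stage.\<close>
      then have "a \<in> T m"
        using Suc.IH[of "{a}"] Suc.prems by auto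
      then have "\<exists>x y u. a = (1 - u) *\<^sub>R x + u *\<^sub>R y \<and> 0 \<le> u \<and> u \<le> 1 \<and> x \<in> S \<and> y \<in> T m"
        using 2 Suc.prems by (intro exI[of _ a] exI[of _ 0]) auto
      then show ?thesis using 2 by (simp add: T_Suc)
    next
      case (3 a A')
      then have "convex hull A' \<subseteq> T m"
        using Suc by auto
      then have "u *\<^sub>R a + v *\<^sub>R b \<in> T (Suc m)"
        if "0 \<le> u" "0 \<le> v" "u + v = 1" "b \<in> convex hull A'" for u v b
      proof -
        have "u = 1 - v" "v \<le> 1" "a \<in> S" "b \<in> T m"
          using that 3 Suc.prems \<open>convex hull A' \<subseteq> T m\<close> by auto
        then show ?thesis
          unfolding T_Suc using that by blast
      qed
      then show ?thesis
        unfolding 3 convex_hull_insert[OF \<open>A' \<noteq> {}\<close>] by blast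
    qed simp
  qed
  have "x \<in> T (card B)" if x: "x \<in> convex hull S" for x
  proof -
    obtain A where "finite A" "A \<subseteq> S" "card A \<le> Suc (card B)" "x \<in> convex hull A"
      using caratheodory_finite_span[OF assms(2,3) x] .
    then show ?thesis using hull[of A "card B"] by auto
  qed
  then have "convex hull S = T (card B)"
    using subset[of "card B"] by blast
  with compact show ?thesis by simp
qed

text \<open>Each member of a convergent sequence is a multiple of a point of the compact hull. Along
  a subsequence these points converge to some \<open>b\<close>, and since \<open>b\<close> is
  nonzero the multipliers converge as well.\<close>

lemma closed_convex_cone_hull:
  fixes S :: "'a::real_normed_vector set"
  assumes "compact (convex hull S)" "0 \<notin> convex hull S"
  shows "closed (convex_cone hull S)"
  unfolding closed_sequential_limits
proof (intro allI impI, elim conjE)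
  fix f :: "nat \<Rightarrow> 'a" and l
  assume f: "\<forall>n. f n \<in> convex_cone hull S" and lim: "f \<longlonglongrightarrow> l"
  show "l \<in> convex_cone hull S"
  proof (cases "S = {}")
    case True
    then have "f = (\<lambda>_. 0)" using f by auto
    then show ?thesis
      using lim convex_cone_hull_contains_0 LIMSEQ_unique tendsto_const by metis
  next
    case False
    \<comment> \<open>As \<open>y\<close> is nonzero, norms determine the multiplier. Written as
      this quotient, its limit follows from those of \<open>f\<close> and \<open>y\<close>.\<close>
    have "\<exists>y. y \<in> convex hull S \<and> f n = (norm (f n) / norm y) *\<^sub>R y" for n
    proof -
      have "f n \<in> (\<Union>x \<in> convex hull S. \<Union>c\<in>{0..}. {c *\<^sub>R x})"
        using f False by (metis convex_cone_hull_convex_hull_nonempty)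
      then obtain c y where "0 \<le> c" "y \<in> convex hull S" "f n = c *\<^sub>R y"
        by blast
      then show ?thesis
        using assms(2) by (intro exI[of _ y]) auto
    qed
    then obtain y where y: "\<And>n. y n \<in> convex hull S"
      and fy: "\<And>n. f n = (norm (f n) / norm (y n)) *\<^sub>R y n"
      by metis
    obtain b r where b: "b \<in> convex hull S" and r: "strict_mono r" and yb: "(y \<circ> r) \<longlonglongrightarrow> b"
      using assms(1) y unfolding compact_def by blast
    have fr: "(f \<circ> r) \<longlonglongrightarrow> l"
      using lim r by (rule LIMSEQ_subseq_LIMSEQ)
    have "b \<noteq> 0" using b assms(2) by blast
    then have "(\<lambda>n. (norm ((f \<circ> r) n) / norm ((y \<circ> r) n)) *\<^sub>R (y \<circ> r) n)
      \<longlonglongrightarrow> (norm l / norm b) *\<^sub>R b"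
      by (intro tendsto_intros fr yb) simp
    then have "(f \<circ> r) \<longlonglongrightarrow> (norm l / norm b) *\<^sub>R b"
      by (simp add: fy[symmetric] comp_def)
    then have "l = (norm l / norm b) *\<^sub>R b"
      using fr LIMSEQ_unique by blast
    then show ?thesis
      using convex_cone_hull_mul[of b S "norm l / norm b"] b convex_hull_subset_convex_cone_hull
      by fastforce
  qed
qed

section \<open>Polynomials as a normed space\<close>

lemma lookup_scaleR [simp]: "Poly_Mapping.lookup (c *\<^sub>R p) t = c *\<^sub>R Poly_Mapping.lookup p t"
  for p :: "'a \<Rightarrow>\<^sub>0 'b::real_vector"
proof -
  have "finite {i. c *\<^sub>R Poly_Mapping.lookup p i \<noteq> 0}"
    by (rule finite_subset[OF _ finite_lookup[of p]]) auto
  then show ?thesis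
    by (simp add: scaleR_poly_mapping_def)
qed

lemma keys_scaleR: "Poly_Mapping.keys (c *\<^sub>R p) \<subseteq> Poly_Mapping.keys p"
  for p :: "'a \<Rightarrow>\<^sub>0 'b::real_vector"
  by (auto simp: in_keys_iff)

text \<open>Turns scaling into multiplication by a constant polynomial, so that ring laws yield
  \<open>power2_scaleR\<close>.\<close>

lemma scaleR_eq_single_times: "c *\<^sub>R p = Poly_Mapping.single 0 c * p"
  for p :: "'a::monoid_add \<Rightarrow>\<^sub>0 real"
  by (rule poly_mapping_eqI)
    (simp flip: mult_map_scale_conv_mult add: Poly_Mapping.map.rep_eq when_def)

lemma power2_scaleR: "(c *\<^sub>R p)\<^sup>2 = c\<^sup>2 *\<^sub>R p\<^sup>2"
  for p :: "'a::comm_monoid_add \<Rightarrow>\<^sub>0 real"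
  by (simp add: scaleR_eq_single_times power_mult_distrib power2_eq_square flip: mult_single[of 0 c 0 c, simplified])

lemma poly_mapping_eq_sum_single:
  fixes p :: "'a \<Rightarrow>\<^sub>0 'b::comm_monoid_add"
  assumes "finite M" "Poly_Mapping.keys p \<subseteq> M"
  shows "p = (\<Sum>t\<in>M. Poly_Mapping.single t (Poly_Mapping.lookup p t))"
proof (rule poly_mapping_eqI)
  fix s
  show "Poly_Mapping.lookup p s =
      Poly_Mapping.lookup (\<Sum>t\<in>M. Poly_Mapping.single t (Poly_Mapping.lookup p t)) s"
    using assms
    by (auto simp: lookup_sum lookup_single when_def in_keys_iff)
qed

lemma norm_lookup_le: "norm (Poly_Mapping.lookup p t) \<le> norm p"
  for p :: "'a \<Rightarrow>\<^sub>0 'b::real_normed_vector"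
proof (cases "t \<in> Poly_Mapping.keys p")
  case True
  then show ?thesis
    unfolding norm_poly_mapping_def dist_poly_mapping_def by (auto intro: member_le_sum)
qed (simp add: in_keys_iff)

lemma bounded_linear_lookup: "bounded_linear (\<lambda>p :: 'a \<Rightarrow>\<^sub>0 'b::real_normed_vector. Poly_Mapping.lookup p t)"
  by (rule bounded_linear_intro[of _ 1]) (simp_all add: lookup_add norm_lookup_le)

text \<open>Bounding the coefficients one by one makes the set a product of balls. The induction
  splits off one exponent \<open>t\<close> and writes the set as a continuous image of a ball times
  the smaller set.\<close>

lemma compact_norm_le_keys_subset:
  fixes M :: "'a set"
  assumes "finite M"
  shows "compact {p :: 'a \<Rightarrow>\<^sub>0 'b::euclidean_space.
    Poly_Mapping.keys p \<subseteq> M \<and> (\<forall>t. norm (Poly_Mapping.lookup p t) \<le> r)}"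
    (is "compact (?C M)")
  using assms
proof (induction M)
  case empty
  then show ?case by (rule_tac finite_imp_compact) (simp add: conj_commute)
next
  case (insert t M)
  have "bounded_linear (Poly_Mapping.single t :: 'b \<Rightarrow> _)"
    by (rule bounded_linear_intro[of _ 1])
      (auto intro!: poly_mapping_eqI simp: lookup_add lookup_single when_def norm_poly_mapping_def dist_poly_mapping_def)
  then have "bounded_linear (\<lambda>z. Poly_Mapping.single t (fst z :: 'b) + snd z)"
    by (intro bounded_linear_add bounded_linear_compose[OF _ bounded_linear_fst] bounded_linear_snd)
  then have "continuous_on UNIV (\<lambda>(c :: 'b, p). Poly_Mapping.single t c + p)"
    unfolding case_prod_unfold by (rule linear_continuous_on)
  moreover have "compact (cball (0 :: 'b) r \<times> ?C M)"
    using insert by (intro compact_Times) auto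
  ultimately have "compact ((\<lambda>(c, p). Poly_Mapping.single t c + p) ` (cball 0 r \<times> ?C M))"
    using compact_continuous_image continuous_on_subset by blast
  also have "(\<lambda>(c, p). Poly_Mapping.single t c + p) ` (cball 0 r \<times> ?C M) = ?C (insert t M)"
  proof (intro subset_antisym subsetI)
    fix q assume "q \<in> (\<lambda>(c, p). Poly_Mapping.single t c + p) ` (cball 0 r \<times> ?C M)"
    then obtain c p where q: "q = Poly_Mapping.single t c + p" and c: "norm c \<le> r" and p: "p \<in> ?C M"
      by auto
    have "Poly_Mapping.lookup p t = 0"
      using p insert.hyps by (auto simp: in_keys_iff)
    then have "Poly_Mapping.lookup q s = (if s = t then c else Poly_Mapping.lookup p s)" for s
      by (simp add: q lookup_add lookup_single when_def)
    then show "q \<in> ?C (insert t M)"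
      using c p by (auto simp: in_keys_iff subset_iff split: if_splits)
  next
    fix q assume q: "q \<in> ?C (insert t M)"
    define p where "p = q - Poly_Mapping.single t (Poly_Mapping.lookup q t)"
    have "Poly_Mapping.lookup p s = (if s = t then 0 else Poly_Mapping.lookup q s)" for s
      by (simp add: p_def lookup_minus lookup_single when_def)
    \<comment> \<open>Removing the term at \<open>t\<close> leaves the coefficient 0 there, which
      has to obey the bound \<open>r\<close> too.\<close>
    moreover have "0 \<le> r"
      using q order_trans[OF norm_ge_zero] by blast
    ultimately have "p \<in> ?C M"
      using q by (auto simp: in_keys_iff subset_iff split: if_splits)
    moreover have "q = Poly_Mapping.single t (Poly_Mapping.lookup q t) + p"
      by (simp add: p_def)
    ultimately show "q \<in> (\<lambda>(c, p). Poly_Mapping.single t c + p) ` (cball 0 r \<times> ?C M)"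
      using q by (intro image_eqI[of _ _ "(Poly_Mapping.lookup q t, p)"]) auto
  qed
  finally show ?case .
qed

lemma power2_eq_double_sum:
  fixes p :: "'a::monoid_add \<Rightarrow>\<^sub>0 real"
  assumes "finite M" "Poly_Mapping.keys p \<subseteq> M"
  shows "p\<^sup>2 = (\<Sum>s\<in>M. \<Sum>t\<in>M.
    Poly_Mapping.single (s + t) (Poly_Mapping.lookup p s * Poly_Mapping.lookup p t))"
  by (subst (1) poly_mapping_eq_sum_single[OF assms])
    (simp add: power2_eq_square sum_product mult_single)

lemma single_eq_scaleR: "Poly_Mapping.single t c = c *\<^sub>R Poly_Mapping.single t (1::real)"
  by (rule poly_mapping_eqI) (simp add: lookup_single when_def)

text \<open>With the support confined to a fixed finite set, squaring is a finite sum of products of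
  coefficients, each depending continuously on \<open>p\<close>.\<close>

lemma continuous_on_power2_keys_subset:
  fixes M :: "'a::monoid_add set"
  assumes "finite M"
  shows "continuous_on {p :: 'a \<Rightarrow>\<^sub>0 real. Poly_Mapping.keys p \<subseteq> M} (\<lambda>p. p\<^sup>2)"
proof -
  have "continuous_on {p. Poly_Mapping.keys p \<subseteq> M} (\<lambda>p :: 'a \<Rightarrow>\<^sub>0 real. \<Sum>s\<in>M. \<Sum>t\<in>M.
      (Poly_Mapping.lookup p s * Poly_Mapping.lookup p t) *\<^sub>R Poly_Mapping.single (s + t) 1)"
    by (intro continuous_intros bounded_linear.continuous_on[OF bounded_linear_lookup])
  then show ?thesis
    by (rule continuous_on_eq) (simp add: power2_eq_double_sum[OF assms] flip: single_eq_scaleR)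
qed

section \<open>Positivity of squares in the lexicographic order\<close>

text \<open>The order given by \<open>less_fun\<close> compares two families at the least index
  where they differ; against 0 this is the sign of the lowest nonzero coefficient.\<close>

lemma zero_less_poly_mapping_iff:
  fixes p :: "'a::linorder \<Rightarrow>\<^sub>0 'b::{zero,linorder}"
  shows "0 < p \<longleftrightarrow> (\<exists>t. 0 < Poly_Mapping.lookup p t \<and> (\<forall>s<t. Poly_Mapping.lookup p s = 0))"
  by transfer (auto simp: less_fun_def)

text \<open>If \<open>m\<close> is the lowest exponent of \<open>p\<close>, then
  \<open>m + m\<close> is the lowest exponent of the square and arises only from the pair
  \<open>(m, m)\<close>, so its coefficient is a nonzero square. For \<open>rpoly\<close>, exponents
  are compared by their own lexicographic order.\<close>

lemma power2_poly_mapping_pos: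
  fixes p :: "'a::{ordered_cancel_comm_monoid_add,linorder} \<Rightarrow>\<^sub>0 real"
  assumes "p \<noteq> 0"
  shows "0 < p\<^sup>2"
proof -
  define m where "m = Min (Poly_Mapping.keys p)"
  have m: "m \<in> Poly_Mapping.keys p" "\<And>s. s \<in> Poly_Mapping.keys p \<Longrightarrow> m \<le> s"
    using assms by (simp_all add: m_def)
  have lookup: "Poly_Mapping.lookup (p\<^sup>2) u = (\<Sum>s\<in>Poly_Mapping.keys p. \<Sum>t\<in>Poly_Mapping.keys p.
      Poly_Mapping.lookup p s * Poly_Mapping.lookup p t when s + t = u)" for u
    by (simp add: power2_eq_double_sum[of "Poly_Mapping.keys p"] lookup_sum lookup_single)
  have "Poly_Mapping.lookup (p\<^sup>2) u = 0" if "u < m + m" for u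
    unfolding lookup
  proof (intro sum.neutral ballI)
    fix s t assume "s \<in> Poly_Mapping.keys p" "t \<in> Poly_Mapping.keys p"
    then have "m + m \<le> s + t" by (intro add_mono m)
    then show "(Poly_Mapping.lookup p s * Poly_Mapping.lookup p t when s + t = u) = 0"
      using that by auto
  qed
  moreover have "Poly_Mapping.lookup (p\<^sup>2) (m + m) = (Poly_Mapping.lookup p m)\<^sup>2"
  proof -
    \<comment> \<open>Addition is strictly monotone: if either exponent exceeded \<open>m\<close>,
      the sum would exceed \<open>m + m\<close>.\<close>
    have min_unique: "s = m \<and> t = m" if "s \<in> Poly_Mapping.keys p" "t \<in> Poly_Mapping.keys p" "s + t = m + m" for s t
    proof (rule ccontr)
      assume "\<not> (s = m \<and> t = m)"
      then have "m < s \<or> m < t"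
        using m(2) that(1,2) by (auto simp: order.strict_iff_order)
      then have "m + m < s + t"
        using m(2) that(1,2) by (auto intro: add_less_le_mono add_le_less_mono)
      then show False using that(3) by simp
    qed
    have "Poly_Mapping.lookup (p\<^sup>2) (m + m) = (\<Sum>s\<in>Poly_Mapping.keys p. \<Sum>t\<in>Poly_Mapping.keys p.
      if s = m then if t = m then (Poly_Mapping.lookup p m)\<^sup>2 else 0 else 0)"
      unfolding lookup
    proof (intro sum.cong refl)
      fix s t assume "s \<in> Poly_Mapping.keys p" "t \<in> Poly_Mapping.keys p"
      then show "(Poly_Mapping.lookup p s * Poly_Mapping.lookup p t when s + t = m + m) =
          (if s = m then if t = m then (Poly_Mapping.lookup p m)\<^sup>2 else 0 else 0)"
        by (cases "s + t = m + m") (auto simp: power2_eq_square dest: min_unique)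
    qed
    also have "\<dots> = (\<Sum>s\<in>Poly_Mapping.keys p. if s = m then (Poly_Mapping.lookup p m)\<^sup>2 else 0)"
      using m(1) by (intro sum.cong refl) simp
    also have "\<dots> = (Poly_Mapping.lookup p m)\<^sup>2"
      using m(1) by simp
    finally show ?thesis .
  qed
  ultimately show ?thesis
    using m(1) unfolding zero_less_poly_mapping_iff by (auto simp: in_keys_iff intro!: exI[of _ "m + m"])
qed

lemma convex_poly_mapping_pos: "convex {p :: 'a::linorder \<Rightarrow>\<^sub>0 real. 0 < p}"
proof -
  have scale: "0 < c *\<^sub>R p" if "0 < c" "0 < p" for c and p :: "'a \<Rightarrow>\<^sub>0 real"
    using that unfolding zero_less_poly_mapping_iff by (metis lookup_scaleR mult_pos_pos real_scaleR_def scaleR_zero_right)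
  show ?thesis
    unfolding convex_alt
  proof safe
    fix p q :: "'a \<Rightarrow>\<^sub>0 real" and u :: real
    assume "0 < p" "0 < q" "0 \<le> u" "u \<le> 1"
    \<comment> \<open>Strictly inside the segment both summands are positive; at an endpoint one of
      them vanishes.\<close>
    then show "0 < (1 - u) *\<^sub>R p + u *\<^sub>R q"
      by (cases "u = 0"; cases "u = 1") (auto intro!: add_pos_pos scale)
  qed
qed

section \<open>Sums of squares of sparse forms\<close>

text \<open>Provides the finite spanning set that the Caratheodory argument requires.\<close>

lemma forms_subset_span_singles:
  "forms n d \<subseteq> span ((\<lambda>t. Poly_Mapping.single t 1) ` monomials n d)"
proof
  fix p assume "p \<in> forms n d"
  then have "p = (\<Sum>t\<in>monomials n d. Poly_Mapping.lookup p t *\<^sub>R Poly_Mapping.single t 1)"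
    using poly_mapping_eq_sum_single[OF finite_monomials, of p n d]
    by (simp add: forms_def flip: single_eq_scaleR)
  also have "\<dots> \<in> span ((\<lambda>t. Poly_Mapping.single t 1) ` monomials n d)"
    by (intro span_sum span_scale span_base) auto
  finally show "p \<in> span ((\<lambda>t. Poly_Mapping.single t 1) ` monomials n d)" .
qed

lemma convex_cone_forms: "convex_cone (forms n d)"
  unfolding convex_cone_iff forms_def
  by (auto dest!: subsetD[OF Poly_Mapping.keys_add] subsetD[OF keys_scaleR])

lemma add_mem_monomials: "s \<in> monomials n d \<Longrightarrow> t \<in> monomials n e \<Longrightarrow> s + t \<in> monomials n (d + e)"
  using Poly_Mapping.keys_add[of s t] by (auto simp: monomials_def lookup_add sum.distrib)

lemma power2_mem_forms: "p \<in> forms n d \<Longrightarrow> p\<^sup>2 \<in> forms n (2 * d)"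
  for p :: rpoly
  using add_mem_monomials[of _ n d _ d]
  by (auto simp: forms_def power2_eq_square mult_2 dest!: subsetD[OF keys_mult])

lemma scaleR_mem_sparse_forms: "p \<in> sparse_forms n d k \<Longrightarrow> c *\<^sub>R p \<in> sparse_forms n d k"
  using keys_scaleR[where c = c and p = p] card_mono[OF finite_keys, of "Poly_Mapping.keys (c *\<^sub>R p)" p]
  by (auto simp: sparse_forms_def forms_def)

lemma sparse_sos_add:
  assumes "p \<in> sparse_sos n d k" "q \<in> sparse_sos n d k"
  shows "p + q \<in> sparse_sos n d k"
proof -
  obtain m m' :: nat and h h' :: "nat \<Rightarrow> rpoly" where
    p: "p = (\<Sum>j=1..m. (h j)\<^sup>2)" "\<forall>j\<in>{1..m}. h j \<in> sparse_forms n d k" and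
    q: "q = (\<Sum>j=1..m'. (h' j)\<^sup>2)" "\<forall>j\<in>{1..m'}. h' j \<in> sparse_forms n d k"
    using assms unfolding sparse_sos_def by blast
  \<comment> \<open>Concatenation of the two families: \<open>h\<close> on the indices up to
    \<open>m\<close>, then \<open>h'\<close> shifted by \<open>m\<close>.\<close>
  define g where "g j = (if j \<le> m then h j else h' (j - m))" for j
  have "(\<Sum>j=1..m + m'. (g j)\<^sup>2) = (\<Sum>j=1..m. (g j)\<^sup>2) + (\<Sum>j=m + 1..m + m'. (g j)\<^sup>2)"
    by (intro sum.ub_add_nat) simp
  also have "(\<Sum>j=1..m. (g j)\<^sup>2) = p"
    by (simp add: p g_def)
  also have "(\<Sum>j=m + 1..m + m'. (g j)\<^sup>2) = (\<Sum>j=1..m'. (g (j + m))\<^sup>2)"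
    using sum.shift_bounds_cl_nat_ivl[of "\<lambda>j. (g j)\<^sup>2" 1 m m'] by (simp add: add.commute)
  also have "\<dots> = q"
    unfolding q by (intro sum.cong) (auto simp: g_def)
  finally have "p + q = (\<Sum>j=1..m + m'. (g j)\<^sup>2)" ..
  moreover have "g j \<in> sparse_forms n d k" if "j \<in> {1..m + m'}" for j
  proof (cases "j \<le> m")
    case False
    then have "j - m \<in> {1..m'}"
      using that by auto
    then show ?thesis
      using False q(2) by (simp add: g_def)
  qed (use that p(2) in \<open>simp add: g_def\<close>)
  ultimately show ?thesis
    unfolding sparse_sos_def mem_Collect_eq by (intro exI conjI ballI)
qed

lemma convex_cone_sparse_sos: "convex_cone (sparse_sos n d k)"
  unfolding convex_cone_iff
proof (intro conjI ballI allI impI)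
  show "0 \<in> sparse_sos n d k"
    unfolding sparse_sos_def by (force intro: exI[of _ 0])
  show "p + q \<in> sparse_sos n d k" if "p \<in> sparse_sos n d k" "q \<in> sparse_sos n d k" for p q
    using that by (rule sparse_sos_add)
  show "c *\<^sub>R p \<in> sparse_sos n d k" if p: "p \<in> sparse_sos n d k" and c: "0 \<le> c" for p c
  proof -
    obtain m :: nat and h :: "nat \<Rightarrow> rpoly" where h: "p = (\<Sum>j=1..m. (h j)\<^sup>2)" "\<forall>j\<in>{1..m}. h j \<in> sparse_forms n d k"
      using p unfolding sparse_sos_def by blast
    \<comment> \<open>A nonnegative factor is absorbed into the squares through its square root,
      which leaves the summands sparse.\<close>
    have "c *\<^sub>R p = (\<Sum>j=1..m. (sqrt c *\<^sub>R h j)\<^sup>2)"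
      using c by (simp add: h(1) power2_scaleR scaleR_sum_right)
    moreover have "\<forall>j\<in>{1..m}. sqrt c *\<^sub>R h j \<in> sparse_forms n d k"
      using h(2) scaleR_mem_sparse_forms by blast
    ultimately show ?thesis
      unfolding sparse_sos_def mem_Collect_eq by (intro exI conjI)
  qed
qed

lemma convex_cone_sum:
  assumes "convex_cone C" "\<And>i. i \<in> I \<Longrightarrow> f i \<in> C"
  shows "sum f I \<in> C"
  using assms(2) by (induction I rule: infinite_finite_induct)
    (simp_all add: assms(1) convex_cone_add convex_cone_contains_0)

text \<open>The norm condition is on \<open>h\<close> rather than on its square, so the set is the
  image under squaring of a piece of the unit sphere.\<close>

definition unit_squares :: "nat \<Rightarrow> nat \<Rightarrow> nat \<Rightarrow> rpoly set" where
  "unit_squares n d k = (\<lambda>h. h\<^sup>2) ` {h \<in> sparse_forms n d k. norm h = 1}"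

text \<open>Normalising a nonzero sparse form keeps it sparse, so its square is a nonnegative
  multiple of a unit square.\<close>

lemma sparse_sos_eq_hull: "sparse_sos n d k = convex_cone hull (unit_squares n d k)"
proof
  show "convex_cone hull (unit_squares n d k) \<subseteq> sparse_sos n d k"
  proof (rule hull_minimal)
    show "unit_squares n d k \<subseteq> sparse_sos n d k"
      unfolding unit_squares_def sparse_sos_def by (force intro: exI[of _ 1])
  qed (rule convex_cone_sparse_sos)
  have "h\<^sup>2 \<in> convex_cone hull (unit_squares n d k)" if h: "h \<in> sparse_forms n d k" for h
  proof (cases "h = 0")
    case False
    have "h\<^sup>2 = (norm h)\<^sup>2 *\<^sub>R ((1 / norm h) *\<^sub>R h)\<^sup>2"
      using False by (simp add: power2_scaleR power_divide)
    moreover have "((1 / norm h) *\<^sub>R h)\<^sup>2 \<in> unit_squares n d k"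
      unfolding unit_squares_def
      using h False scaleR_mem_sparse_forms by (intro imageI) simp
    ultimately show ?thesis
      by (metis convex_cone_hull_mul hull_inc zero_le_power2)
  qed (simp add: convex_cone_hull_contains_0)
  then show "sparse_sos n d k \<subseteq> convex_cone hull (unit_squares n d k)"
    unfolding sparse_sos_def by (auto intro!: convex_cone_sum convex_cone_convex_cone_hull)
qed

text \<open>Sparse forms are a finite union of coordinate subspaces, one for each set
  \<open>T\<close> of at most \<open>k\<close> monomials. On the unit sphere every coefficient is
  bounded by 1, so each subspace may be replaced by a compact box.\<close>

lemma compact_unit_sparse_forms: "compact {h \<in> sparse_forms n d k. norm h = 1}"
proof -
  let ?C = "\<lambda>T. {h :: rpoly. Poly_Mapping.keys h \<subseteq> T \<and> (\<forall>t. norm (Poly_Mapping.lookup h t) \<le> 1)}"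
  let ?I = "{T. T \<subseteq> monomials n d \<and> card T \<le> k}"
  have eq: "{h \<in> sparse_forms n d k. norm h = 1} = (\<Union>T\<in>?I. ?C T) \<inter> {h. norm h = 1}"
  proof (intro subset_antisym subsetI)
    fix h assume h: "h \<in> {h \<in> sparse_forms n d k. norm h = 1}"
    then have "Poly_Mapping.keys h \<in> ?I" "h \<in> ?C (Poly_Mapping.keys h)"
      using norm_lookup_le[of h] by (auto simp: sparse_forms_def forms_def)
    then show "h \<in> (\<Union>T\<in>?I. ?C T) \<inter> {h. norm h = 1}"
      using h by auto
  next
    fix h assume "h \<in> (\<Union>T\<in>?I. ?C T) \<inter> {h. norm h = 1}"
    then obtain T where T: "T \<subseteq> monomials n d" "card T \<le> k" "Poly_Mapping.keys h \<subseteq> T" and "norm h = 1"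
      by auto
    moreover have "card (Poly_Mapping.keys h) \<le> card T"
      using T finite_subset[OF T(1) finite_monomials] by (intro card_mono)
    ultimately show "h \<in> {h \<in> sparse_forms n d k. norm h = 1}"
      by (auto simp: sparse_forms_def forms_def)
  qed
  have "compact (\<Union>T\<in>?I. ?C T)"
  proof (rule compact_UN)
    show "finite ?I"
      using finite_monomials by (auto intro: finite_subset[of _ "Pow (monomials n d)"])
    show "compact (?C T)" if "T \<in> ?I" for T
      using that finite_subset[OF _ finite_monomials] by (intro compact_norm_le_keys_subset) blast
  qed
  then show ?thesis
    unfolding eq by (intro compact_Int_closed closed_Collect_eq continuous_intros)
qed

lemma compact_unit_squares: "compact (unit_squares n d k)"
  unfolding unit_squares_def
proof (intro compact_continuous_image compact_unit_sparse_forms)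
  show "continuous_on {h \<in> sparse_forms n d k. norm h = 1} (\<lambda>h. h\<^sup>2)"
    by (rule continuous_on_subset[OF continuous_on_power2_keys_subset[OF finite_monomials]])
      (auto simp: sparse_forms_def forms_def)
qed

text \<open>The positive polynomials form a convex set that contains all unit squares but not
  0.\<close>

lemma zero_notin_hull_unit_squares: "0 \<notin> convex hull (unit_squares n d k)"
proof -
  have "unit_squares n d k \<subseteq> {p. 0 < p}"
    by (auto simp: unit_squares_def intro!: power2_poly_mapping_pos)
  then have "convex hull (unit_squares n d k) \<subseteq> {p. 0 < p}"
    by (intro hull_minimal convex_poly_mapping_pos)
  then show ?thesis by auto
qed

lemma unit_squares_subset_forms: "unit_squares n d k \<subseteq> forms n (2 * d)"
  by (auto simp: unit_squares_def sparse_forms_def power2_mem_forms)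

lemma sparse_sos_subset_forms: "sparse_sos n d k \<subseteq> forms n (2 * d)"
  unfolding sparse_sos_eq_hull
  by (intro hull_minimal unit_squares_subset_forms convex_cone_forms)

theorem theorem1p1:
  fixes n d k :: nat
  assumes "n \<ge> 1" and "d \<ge> 1" and "k \<ge> 1"
  shows "sparse_sos n d k \<subseteq> forms n (2 * d)
    \<and> convex_cone (sparse_sos n d k)
    \<and> closedin (top_of_set (forms n (2 * d))) (sparse_sos n d k)"
proof (intro conjI closed_subset sparse_sos_subset_forms convex_cone_sparse_sos)
  \<comment> \<open>By \<open>closed_subset\<close>, closedness in all of \<open>rpoly\<close> and
    the inclusion in the forms give relative closedness. The monomials have degree
    \<open>2 * d\<close> because the hull is taken of squares.\<close>
  let ?B = "(\<lambda>t. Poly_Mapping.single t (1::real)) ` monomials n (2 * d)"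
  have "unit_squares n d k \<subseteq> span ?B"
    using unit_squares_subset_forms forms_subset_span_singles by (rule order_trans)
  then have "compact (convex hull (unit_squares n d k))"
    using compact_unit_squares finite_monomials by (intro compact_convex_hull_finite_span) auto
  then show "closed (sparse_sos n d k)"
    unfolding sparse_sos_eq_hull
    using zero_notin_hull_unit_squares by (rule closed_convex_cone_hull)
qed

end
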